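(* Assume (A1), (A2), (A3) of the context. Let $\{(x^k,\epsilon^k)\}$ be generated by the algorithm DIRL$_2$ and let $\Omega$ be the set of limit points of $\{x^k\}$. Let $x^*\in\Omega$, and suppose that $\mathcal J(x^* )=\emptyset$ or $r'(0^+)=\infty$. Then $x^*$ is a stationary point of the problem $\min_x F(x)$.
   Context: Let $f:\mathbb R^n\to\mathbb R$ be twice continuously differentiable, $\lambda>0$, $F(x)=f(x)+\lambda\sum_{i=1}^n r(|x_i|)$. (A1) $r:[0,\infty)\to\mathbb R$ is continuous and concave, $r(0)=0$, $C^2$ on $(0,\infty)$, $r'(t)\ge0$ for all $t>0$, and $r'(0^+):=\lim_{t\to0^+}r'(t)\in(0,\infty]$. (A2) Every $x$ with $0\in\partial F(x)$ satisfies $0\in\mathrm{rint}\,\partial F(x)$ ($\partial F$ the regular subdifferential, $\mathrm{rint}$ the relative interior). (A3) With $F(x,\epsilon)=f(x)+\lambda\sum_{i=1}^n r\big(\sqrt{x_i^2+\epsilon_i^2}\big)$ and $F^0=F(x^0,\epsilon^0)$ for the initial point, $\mathcal L(F^0)=\{x:F(x)\le F^0\}$ is bounded. $L_{\nabla f}$ is a Lipschitz constant of $\nabla f$ on $\mathcal L(F^0)$. $\mathcal I(x)=\{i:x_i\ne0\}$, $\mathcal J(x)=\{i:x_i=0\}$. A point $x^*$ is stationary if $\nabla_i f(x^* )=-\lambda\,\mathrm{sign}(x_i^* )r'(|x_i^*|)$ for $i\in\mathcal I(x^* )$ and $\nabla_i f(x^* )\in(-\lambda r'(0^+),\lambda r'(0^+))$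 for $i\in\mathcal J(x^* )$. DIRL$_2$: input $x^0\in\mathbb R^n$, $\epsilon^0$ with all entries positive, $\alpha,\mu\in(0,1)$, $\beta>0$, $\beta>\alpha L_{\nabla f}/2$. For $k=0,1,\dots$: $u_i^k=\dfrac{r'(\sqrt{(x_i^k)^2+(\epsilon_i^k)^2})}{2\sqrt{(x_i^k)^2+(\epsilon_i^k)^2}}$; $y^k=\arg\min_{y\in\mathbb R^n}\{\nabla f(x^k)^Ty+\frac\beta2\|x^k-y\|^2+\lambda\sum_i u_i^k y_i^2\}$; $x^{k+1}=(1-\alpha)x^k+\alpha y^k$; $\epsilon^{k+1}=(1-\alpha(1-\mu))\epsilon^k$. *)

theory Defs
  imports "HOL-Analysis.Analysis"
begin

section \<open>Differential notions\<close>

definition grad :: "('a::euclidean_space \<Rightarrow> real) \<Rightarrow> 'a \<Rightarrow> 'a" where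
  "grad f x = (THE D. GDERIV f x :> D)"

text \<open>Only used for open \<^term>\<open>S\<close>, where the derivatives are unrestricted Frechet derivatives.\<close>

definition C2_on :: "'a::euclidean_space set \<Rightarrow> ('a \<Rightarrow> real) \<Rightarrow> bool" where
  "C2_on S f \<longleftrightarrow>
     (\<exists>(f' :: 'a \<Rightarrow> 'a \<Rightarrow>\<^sub>L real) (f'' :: 'a \<Rightarrow> 'a \<Rightarrow>\<^sub>L ('a \<Rightarrow>\<^sub>L real)).
        (\<forall>x\<in>S. (f has_derivative blinfun_apply (f' x)) (at x)) \<and>
        (\<forall>x\<in>S. (f' has_derivative blinfun_apply (f'' x)) (at x)) \<and>
        continuous_on S f'')"

text \<open>Regular (Frechet) subgradients: those \<^term>\<open>v\<close> with
  \<^prop>\<open>F y \<ge> F x + v \<bullet> (y - x) + e\<close> where \<^term>\<open>e\<close> is of order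
  o(norm (y - x)) as y tends to x.\<close>

definition regular_subdifferential :: "('a::euclidean_space \<Rightarrow> real) \<Rightarrow> 'a \<Rightarrow> 'a set" where
  "regular_subdifferential F x =
     {v. Liminf (at x) (\<lambda>y. ereal ((F y - F x - v \<bullet> (y - x)) / norm (y - x))) \<ge> 0}"


section \<open>The problem\<close>

text \<open>The penalty \<^term>\<open>r\<close> is only evaluated on \<open>[0,\<infinity>)\<close> and \<^term>\<open>deriv r\<close>
  only on \<open>(0,\<infinity>)\<close>; the values of \<^term>\<open>r\<close> at negative arguments are irrelevant.\<close>

definition objective :: "(real ^ 'n \<Rightarrow> real) \<Rightarrow> (real \<Rightarrow> real) \<Rightarrow> real \<Rightarrow> real ^ 'n \<Rightarrow> real" where
  "objective f r lam x = f x + lam * (\<Sum>i\<in>UNIV. r \<bar>x $ i\<bar>)"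

definition smoothed_objective ::
  "(real ^ 'n \<Rightarrow> real) \<Rightarrow> (real \<Rightarrow> real) \<Rightarrow> real \<Rightarrow> real ^ 'n \<Rightarrow> real ^ 'n \<Rightarrow> real" where
  "smoothed_objective f r lam x \<epsilon> = f x + lam * (\<Sum>i\<in>UNIV. r (sqrt ((x $ i)\<^sup>2 + (\<epsilon> $ i)\<^sup>2)))"

text \<open>The limit of r' at 0 from the right, possibly \<open>\<infinity>\<close>.\<close>

definition slope_at_0 :: "(real \<Rightarrow> real) \<Rightarrow> ereal" where
  "slope_at_0 r = Lim (at_right 0) (\<lambda>t. ereal (deriv r t))"

definition admissible_penalty :: "(real \<Rightarrow> real) \<Rightarrow> bool" where
  "admissible_penalty r \<longleftrightarrow>
     continuous_on {0..} r \<and> concave_on {0..} r \<and> r 0 = 0 \<and> C2_on {0<..} r \<and>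
     (\<forall>t>0. deriv r t \<ge> 0) \<and>
     ((\<lambda>t. ereal (deriv r t)) \<longlongrightarrow> slope_at_0 r) (at_right 0) \<and> slope_at_0 r > 0"

definition nondegenerate_critical_points :: "('a::euclidean_space \<Rightarrow> real) \<Rightarrow> bool" where
  "nondegenerate_critical_points F \<longleftrightarrow>
     (\<forall>x. 0 \<in> regular_subdifferential F x \<longrightarrow> 0 \<in> rel_interior (regular_subdifferential F x))"

definition level_set :: "('a \<Rightarrow> real) \<Rightarrow> real \<Rightarrow> 'a set" where
  "level_set F c = {x. F x \<le> c}"

definition nonzero_indices :: "real ^ 'n \<Rightarrow> 'n set" where
  "nonzero_indices x = {i. x $ i \<noteq> 0}"

definition zero_indices :: "real ^ 'n \<Rightarrow> 'n set" where
  "zero_indices x = {i. x $ i = 0}"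

definition stationary ::
  "(real ^ 'n \<Rightarrow> real) \<Rightarrow> (real \<Rightarrow> real) \<Rightarrow> real \<Rightarrow> real ^ 'n \<Rightarrow> bool" where
  "stationary f r lam x \<longleftrightarrow>
     (\<forall>i\<in>nonzero_indices x. grad f x $ i = - lam * sgn (x $ i) * deriv r \<bar>x $ i\<bar>) \<and>
     (\<forall>i\<in>zero_indices x. ereal (grad f x $ i) \<in> {- (ereal lam * slope_at_0 r)<..<ereal lam * slope_at_0 r})"


section \<open>The algorithm\<close>

definition dirl2_weight :: "(real \<Rightarrow> real) \<Rightarrow> real \<Rightarrow> real \<Rightarrow> real" where
  "dirl2_weight r t e = deriv r (sqrt (t\<^sup>2 + e\<^sup>2)) / (2 * sqrt (t\<^sup>2 + e\<^sup>2))"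

definition dirl2_model ::
  "(real ^ 'n \<Rightarrow> real) \<Rightarrow> (real \<Rightarrow> real) \<Rightarrow> real \<Rightarrow> real \<Rightarrow> real ^ 'n \<Rightarrow> real ^ 'n \<Rightarrow> real ^ 'n \<Rightarrow> real" where
  "dirl2_model f r lam \<beta> x \<epsilon> y =
     grad f x \<bullet> y + \<beta> / 2 * (norm (x - y))\<^sup>2
       + lam * (\<Sum>i\<in>UNIV. dirl2_weight r (x $ i) (\<epsilon> $ i) * (y $ i)\<^sup>2)"

text \<open>\<^term>\<open>x\<close> and \<^term>\<open>\<epsilon>\<close> are the iterate sequences started at
  \<^term>\<open>x 0\<close> and \<^term>\<open>\<epsilon> 0\<close>; \<^term>\<open>y\<close> collects the subproblem minimizers.\<close>

definition dirl2_sequence ::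
  "(real ^ 'n \<Rightarrow> real) \<Rightarrow> (real \<Rightarrow> real) \<Rightarrow> real \<Rightarrow> real \<Rightarrow> real \<Rightarrow> real \<Rightarrow>
   (nat \<Rightarrow> real ^ 'n) \<Rightarrow> (nat \<Rightarrow> real ^ 'n) \<Rightarrow> bool" where
  "dirl2_sequence f r lam \<alpha> \<mu> \<beta> x \<epsilon> \<longleftrightarrow>
     (\<exists>y. \<forall>k. is_arg_min (dirl2_model f r lam \<beta> (x k) (\<epsilon> k)) (\<lambda>_. True) (y k) \<and>
              x (Suc k) = (1 - \<alpha>) *\<^sub>R x k + \<alpha> *\<^sub>R y k \<and>
              \<epsilon> (Suc k) = (1 - \<alpha> * (1 - \<mu>)) *\<^sub>R \<epsilon> k)"

text \<open>Limit points of a sequence are limits of its subsequences, not accumulation points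
  of its range.\<close>

definition limit_points :: "(nat \<Rightarrow> 'a::topological_space) \<Rightarrow> 'a set" where
  "limit_points x = {l. \<exists>\<phi>::nat \<Rightarrow> nat. strict_mono \<phi> \<and> (x \<circ> \<phi>) \<longlonglongrightarrow> l}"

end

theory Submission
  imports Defs
begin

text \<open>Along the segment from x^k to x^{k+1} the smoothed objective decreases by a multiple of the
  squared step: r o sqrt is concave, hence majorised by the weighted quadratic of the model, and the
  gradient is Lipschitz as long as the segment stays in the level set. The decrease in turn keeps the
  segment inside the level set, which need not be convex. Along a convergent subsequence the
  objective is bounded below, so the steps tend to 0, and the optimality conditions of the
  subproblems pass to the limit. At the zero components of the limit point the case hypothesis
  leaves nothing to prove.\<close>

section \<open>Gradients and derivatives of C2 functions\<close>

lemma C2_on_UNIV_grad: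
  fixes f :: "'a::euclidean_space \<Rightarrow> real"
  assumes "C2_on UNIV f"
  shows "(f has_derivative (\<lambda>h. grad f x \<bullet> h)) (at x)" and "continuous_on UNIV (grad f)"
proof -
  obtain f' :: "'a \<Rightarrow> 'a \<Rightarrow>\<^sub>L real" and f''
    where f': "\<And>x. (f has_derivative blinfun_apply (f' x)) (at x)"
      and f'': "\<And>x. (f' has_derivative blinfun_apply (f'' x)) (at x)"
    using assms unfolding C2_on_def by blast
  \<comment> \<open>The Riesz representative of \<open>f' x\<close>, written out in the basis: a
    finite sum, so continuity of \<open>f'\<close> carries over to the gradient.\<close>
  define G where "G x = (\<Sum>b\<in>Basis. blinfun_apply (f' x) b *\<^sub>R b)" for x
  have G: "blinfun_apply (f' x) h = h \<bullet> G x" for x h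
  proof -
    have "blinfun_apply (f' x) h = blinfun_apply (f' x) (\<Sum>b\<in>Basis. (h \<bullet> b) *\<^sub>R b)"
      by (simp add: euclidean_representation)
    also have "\<dots> = h \<bullet> G x"
      by (simp add: G_def blinfun.sum_right blinfun.scaleR_right inner_sum_right mult.commute)
    finally show ?thesis .
  qed
  have gderiv: "GDERIV f x :> G x" for x
    unfolding gderiv_def using f'[of x] by (simp add: G[abs_def])
  have grad: "grad f x = G x" for x
    unfolding grad_def
  proof (rule the_equality)
    show "GDERIV f x :> G x" by (rule gderiv)
    show "D = G x" if "GDERIV f x :> D" for D
    proof -
      have "(\<lambda>h. h \<bullet> D) = (\<lambda>h. h \<bullet> G x)"
        using that gderiv[of x] unfolding gderiv_def by (rule has_derivative_unique)
      then show ?thesis by (metis vector_eq_ldot)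
    qed
  qed
  show "(f has_derivative (\<lambda>h. grad f x \<bullet> h)) (at x)"
    using gderiv[of x] by (simp add: grad gderiv_def inner_commute)
  have "continuous_on UNIV f'"
    using f'' has_derivative_continuous by (blast intro: continuous_at_imp_continuous_on)
  then have "continuous_on UNIV G"
    unfolding G_def by (intro continuous_intros)
  then show "continuous_on UNIV (grad f)"
    by (simp add: grad[abs_def])
qed

lemma C2_on_greaterThan_deriv:
  fixes r :: "real \<Rightarrow> real"
  assumes "C2_on {a<..} r"
  shows "a < t \<Longrightarrow> (r has_real_derivative deriv r t) (at t)" and "continuous_on {a<..} (deriv r)"
proof -
  obtain r' :: "real \<Rightarrow> real \<Rightarrow>\<^sub>L real" and r''
    where r': "\<And>t. t > a \<Longrightarrow> (r has_derivative blinfun_apply (r' t)) (at t)"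
      and r'': "\<And>t. t > a \<Longrightarrow> (r' has_derivative blinfun_apply (r'' t)) (at t)"
    using assms unfolding C2_on_def by (metis greaterThan_iff)
  have D: "(r has_real_derivative blinfun_apply (r' t) 1) (at t)" if "t > a" for t
  proof -
    have "blinfun_apply (r' t) = (*) (blinfun_apply (r' t) 1)"
    proof
      show "blinfun_apply (r' t) h = blinfun_apply (r' t) 1 * h" for h
        using blinfun.scaleR_right[of "r' t" h 1] by simp
    qed
    then show ?thesis
      using r'[OF that] unfolding has_field_derivative_def by argo
  qed
  show "a < t \<Longrightarrow> (r has_real_derivative deriv r t) (at t)"
    using D[of t] by (simp add: DERIV_imp_deriv)
  have "continuous_on {a<..} r'"
    using r'' has_derivative_continuous by (blast intro: continuous_at_imp_continuous_on)
  then have "continuous_on {a<..} (\<lambda>t. blinfun_apply (r' t) 1)"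
    by (intro continuous_intros)
  then show "continuous_on {a<..} (deriv r)"
    by (rule continuous_on_eq) (simp add: DERIV_imp_deriv[OF D])
qed

section \<open>Tangents, monotonicity and quadratic majorants of the penalty\<close>

text \<open>A concave function lies below its tangents. The point of tangency is interior, where
  \<open>r\<close> is differentiable, while concavity on the closed half-line admits
  \<open>b = 0\<close>.\<close>

lemma admissible_penalty_tangent:
  assumes "admissible_penalty r" "a > 0" "b \<ge> 0"
  shows "r b \<le> r a + deriv r a * (b - a)"
proof -
  have "(r has_real_derivative deriv r a) (at a)"
    using assms C2_on_greaterThan_deriv(1) unfolding admissible_penalty_def by blast
  then have "((\<lambda>t. - r t) has_real_derivative - deriv r a) (at a within {0..})"
    by (intro DERIV_minus) (rule has_field_derivative_at_within)
  moreover have "convex_on {0..} (\<lambda>t. - r t)"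
    using assms unfolding admissible_penalty_def concave_on_def by blast
  ultimately have "- r b - - r a \<ge> - deriv r a * (b - a)"
    using assms by (intro convex_on_imp_above_tangent[of "{0..}"]) auto
  then show ?thesis by simp
qed

text \<open>The tangent is taken at the larger point \<open>b\<close>: it is positive unless both
  points are 0, so the singular point 0 is covered too.\<close>

lemma admissible_penalty_mono:
  assumes "admissible_penalty r" "0 \<le> a" "a \<le> b"
  shows "r a \<le> r b"
proof (cases "b = 0")
  case False
  then have "deriv r b * (a - b) \<le> 0"
    using assms unfolding admissible_penalty_def by (simp add: mult_nonneg_nonpos)
  then show ?thesis
    using admissible_penalty_tangent[of r b a] False assms by linarith
qed (use assms in auto)

text \<open>As a function of u = t^2 + e^2 the penalty is r(sqrt u), and \<open>dirl2_weight\<close>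
  is its slope r'(sqrt u) / (2 sqrt u). So this is a tangent inequality in u, composed of those of
  \<open>r\<close> and of sqrt; \<open>e > 0\<close> keeps the point of tangency away from
  0.\<close>

lemma penalty_sqrt_le_quadratic:
  assumes "admissible_penalty r" "e > 0"
  shows "r (sqrt (s\<^sup>2 + e\<^sup>2)) \<le> r (sqrt (t\<^sup>2 + e\<^sup>2)) + dirl2_weight r t e * (s\<^sup>2 - t\<^sup>2)"
proof -
  define a b where "a = sqrt (t\<^sup>2 + e\<^sup>2)" and "b = sqrt (s\<^sup>2 + e\<^sup>2)"
  have "a > 0" "b \<ge> 0"
    using assms by (auto simp: a_def b_def intro: add_nonneg_pos)
  have "s\<^sup>2 - t\<^sup>2 = b\<^sup>2 - a\<^sup>2"
    by (simp add: a_def b_def)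
  \<comment> \<open>The tangent inequality of the square root at a^2, in the form (b - a)^2 \<ge> 0.
    Since r' \<ge> 0, it may be multiplied by \<open>deriv r a\<close> below.\<close>
  have "2 * a * (b - a) \<le> b\<^sup>2 - a\<^sup>2"
    using zero_le_power2[of "b - a"] by (simp add: power2_eq_square algebra_simps)
  then have "b - a \<le> (b\<^sup>2 - a\<^sup>2) / (2 * a)"
    using \<open>a > 0\<close> by (simp add: field_simps)
  then have "deriv r a * (b - a) \<le> deriv r a * ((b\<^sup>2 - a\<^sup>2) / (2 * a))"
    using assms \<open>a > 0\<close> unfolding admissible_penalty_def by (intro mult_left_mono) auto
  also have "\<dots> = dirl2_weight r t e * (s\<^sup>2 - t\<^sup>2)"
    by (simp add: dirl2_weight_def \<open>s\<^sup>2 - t\<^sup>2 = b\<^sup>2 - a\<^sup>2\<close> flip: a_def)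
  finally show ?thesis
    using admissible_penalty_tangent[OF assms(1) \<open>a > 0\<close> \<open>b \<ge> 0\<close>] by (simp add: a_def b_def)
qed

lemma dirl2_weight_nonneg:
  assumes "admissible_penalty r" "e > 0"
  shows "dirl2_weight r t e \<ge> 0"
proof -
  have "sqrt (t\<^sup>2 + e\<^sup>2) > 0"
    using assms by (auto intro: add_nonneg_pos)
  then show ?thesis
    using assms unfolding admissible_penalty_def dirl2_weight_def by simp
qed

section \<open>The objective and its smoothing\<close>

lemma continuous_on_objective:
  assumes "continuous_on UNIV f" "continuous_on {0..} r"
  shows "continuous_on UNIV (objective f r lam)"
proof -
  have "continuous_on UNIV (\<lambda>x. r \<bar>x $ i\<bar>)" for i
    by (rule continuous_on_compose2[OF assms(2)]) (auto intro!: continuous_intros)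
  then show ?thesis
    unfolding objective_def using assms(1) by (intro continuous_intros)
qed

text \<open>Smoothing enlarges each argument of the monotone penalty. This turns bounds on the
  smoothed objective into membership in level sets of the objective.\<close>

lemma objective_le_smoothed:
  assumes "admissible_penalty r" "lam > 0"
  shows "objective f r lam x \<le> smoothed_objective f r lam x \<epsilon>"
proof -
  have "r \<bar>x $ i\<bar> \<le> r (sqrt ((x $ i)\<^sup>2 + (\<epsilon> $ i)\<^sup>2))" for i
    using assms(1) by (rule admissible_penalty_mono) (auto simp: real_le_rsqrt)
  then show ?thesis
    unfolding objective_def smoothed_objective_def using assms(2) by (simp add: sum_mono)
qed

lemma smoothed_objective_shrink:
  assumes "admissible_penalty r" "lam > 0" "0 \<le> c" "c \<le> 1"
  shows "smoothed_objective f r lam x (c *\<^sub>R \<epsilon>) \<le> smoothed_objective f r lam x \<epsilon>"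
proof -
  have "r (sqrt ((x $ i)\<^sup>2 + (c * \<epsilon> $ i)\<^sup>2)) \<le> r (sqrt ((x $ i)\<^sup>2 + (\<epsilon> $ i)\<^sup>2))" for i
  proof (rule admissible_penalty_mono[OF assms(1)])
    have "c\<^sup>2 * (\<epsilon> $ i)\<^sup>2 \<le> (\<epsilon> $ i)\<^sup>2"
      using assms by (intro mult_left_le_one_le) (auto simp: power_le_one)
    then show "sqrt ((x $ i)\<^sup>2 + (c * \<epsilon> $ i)\<^sup>2) \<le> sqrt ((x $ i)\<^sup>2 + (\<epsilon> $ i)\<^sup>2)"
      by (simp add: power_mult_distrib)
  qed simp
  then show ?thesis
    unfolding smoothed_objective_def using assms(2) by (simp add: sum_mono)
qed

section \<open>Optimality condition of the subproblem\<close>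

lemma quadratic_nonneg_imp_linear_zero:
  fixes c K :: real
  assumes "\<And>t. 0 \<le> c * t + K * t\<^sup>2"
  shows "c = 0"
proof -
  have "((\<lambda>t. c * t + K * t\<^sup>2) has_real_derivative c) (at 0)"
    by (auto intro!: derivative_eq_intros)
  then show ?thesis
    by (rule DERIV_local_min[of _ _ _ 1]) (use assms in auto)
qed

text \<open>On the line through \<open>y\<close> in direction \<open>d\<close> the model is exactly
  quadratic, so minimality at \<open>y\<close> kills its linear coefficient. The direction stays
  free: \<open>y - x\<close> yields the decrease, coordinate vectors yield the componentwise
  conditions.\<close>

lemma dirl2_model_minimizer:
  assumes "is_arg_min (dirl2_model f r lam \<beta> x \<epsilon>) (\<lambda>_. True) y"
  shows "grad f x \<bullet> d + \<beta> * ((y - x) \<bullet> d)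
           + 2 * lam * (\<Sum>i\<in>UNIV. dirl2_weight r (x $ i) (\<epsilon> $ i) * (y $ i) * (d $ i)) = 0"
proof -
  define w where "w i = dirl2_weight r (x $ i) (\<epsilon> $ i)" for i
  let ?Q = "dirl2_model f r lam \<beta> x \<epsilon>"
  let ?c = "grad f x \<bullet> d + \<beta> * ((y - x) \<bullet> d) + 2 * lam * (\<Sum>i\<in>UNIV. w i * (y $ i) * (d $ i))"
  let ?K = "\<beta> / 2 * (norm d)\<^sup>2 + lam * (\<Sum>i\<in>UNIV. w i * (d $ i)\<^sup>2)"
  have "?Q (y + t *\<^sub>R d) - ?Q y = ?c * t + ?K * t\<^sup>2" for t
  proof -
    have "(\<Sum>i\<in>UNIV. w i * ((y + t *\<^sub>R d) $ i)\<^sup>2) = (\<Sum>i\<in>UNIV. w i * (y $ i)\<^sup>2)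
        + 2 * t * (\<Sum>i\<in>UNIV. w i * (y $ i) * (d $ i)) + t\<^sup>2 * (\<Sum>i\<in>UNIV. w i * (d $ i)\<^sup>2)"
      by (simp add: sum_distrib_left power2_eq_square algebra_simps flip: sum.distrib)
    moreover have "(norm (x - (y + t *\<^sub>R d)))\<^sup>2
        = (norm (x - y))\<^sup>2 + 2 * t * ((y - x) \<bullet> d) + t\<^sup>2 * (norm d)\<^sup>2"
      unfolding power2_norm_eq_inner by (simp add: algebra_simps inner_commute power2_eq_square)
    ultimately show ?thesis
      unfolding dirl2_model_def w_def[symmetric]
      by (simp only: inner_add_right inner_scaleR_right) (simp add: field_simps)
  qed
  moreover have "?Q y \<le> ?Q (y + t *\<^sub>R d)" for t
    using assms by (auto simp: is_arg_min_def not_less)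
  ultimately have "?c = 0"
    by (intro quadratic_nonneg_imp_linear_zero[of _ ?K]) (metis diff_ge_0_iff_ge)
  then show ?thesis by (simp add: w_def)
qed

section \<open>Sufficient decrease\<close>

text \<open>The descent lemma for a single segment inside \<open>S\<close>, so that no convexity of
  \<open>S\<close> is asked for.\<close>

lemma lipschitz_grad_quadratic_bound:
  fixes f :: "'a::euclidean_space \<Rightarrow> real"
  assumes f: "\<And>x. (f has_derivative (\<lambda>h. grad f x \<bullet> h)) (at x)"
    and L: "L-lipschitz_on S (grad f)"
    and S: "\<And>t. 0 \<le> t \<Longrightarrow> t \<le> s \<Longrightarrow> x + t *\<^sub>R d \<in> S" and "0 \<le> s"
  shows "f (x + s *\<^sub>R d) \<le> f x + s * (grad f x \<bullet> d) + L / 2 * s\<^sup>2 * (norm d)\<^sup>2"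
proof -
  \<comment> \<open>The gap between \<open>f\<close> on the segment and its quadratic upper model;
    Cauchy-Schwarz and the Lipschitz bound make its derivative nonpositive.\<close>
  define h where "h t = f (x + t *\<^sub>R d) - t * (grad f x \<bullet> d) - L / 2 * t\<^sup>2 * (norm d)\<^sup>2" for t
  have h': "(h has_real_derivative
      (grad f (x + t *\<^sub>R d) - grad f x) \<bullet> d - L * t * (norm d)\<^sup>2) (at t)" for t
  proof -
    have "((\<lambda>t. f (x + t *\<^sub>R d)) has_derivative (\<lambda>u. grad f (x + t *\<^sub>R d) \<bullet> (u *\<^sub>R d))) (at t)"
      by (rule has_derivative_compose[OF _ f]) (auto intro!: derivative_eq_intros)
    then have "((\<lambda>t. f (x + t *\<^sub>R d)) has_real_derivative grad f (x + t *\<^sub>R d) \<bullet> d) (at t)"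
      by (simp add: has_field_derivative_def mult.commute[of _ "_ \<bullet> _"])
    then show ?thesis
      unfolding h_def by (auto intro!: derivative_eq_intros simp: inner_diff_left)
  qed
  have "h s \<le> h 0"
  proof (rule DERIV_nonpos_imp_nonincreasing[OF \<open>0 \<le> s\<close>])
    fix t assume t: "0 \<le> t" "t \<le> s"
    have "x \<in> S" using S[of 0] \<open>0 \<le> s\<close> by simp
    then have "norm (grad f (x + t *\<^sub>R d) - grad f x) \<le> L * (t * norm d)"
      using lipschitz_onD[OF L S[OF t] \<open>x \<in> S\<close>] t by (simp add: dist_norm)
    then have "norm (grad f (x + t *\<^sub>R d) - grad f x) * norm d \<le> L * (t * norm d) * norm d"
      by (intro mult_right_mono) auto
    then have "(grad f (x + t *\<^sub>R d) - grad f x) \<bullet> d \<le> L * t * (norm d)\<^sup>2"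
      using norm_cauchy_schwarz[of "grad f (x + t *\<^sub>R d) - grad f x" d]
      by (simp add: power2_eq_square mult.assoc)
    then show "\<exists>y. (h has_real_derivative y) (at t) \<and> y \<le> 0"
      using h' by (metis diff_le_0_iff_le)
  qed
  then show ?thesis by (simp add: h_def)
qed

text \<open>The error \<open>E\<close> of the first-order expansion of \<open>f\<close> is a
  parameter because two estimates are plugged in: the quadratic Lipschitz error, and a linear one
  from differentiability at \<open>x\<close> alone.\<close>

lemma dirl2_smoothed_objective_bound:
  assumes r: "admissible_penalty r" and lam: "lam > 0" and \<epsilon>: "\<forall>i. \<epsilon> $ i > 0"
    and y: "is_arg_min (dirl2_model f r lam \<beta> x \<epsilon>) (\<lambda>_. True) y"
    and s: "0 \<le> s" "s \<le> 1"
    and f: "f (x + s *\<^sub>R (y - x)) \<le> f x + s * (grad f x \<bullet> (y - x)) + E"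
  shows "smoothed_objective f r lam (x + s *\<^sub>R (y - x)) \<epsilon>
           \<le> smoothed_objective f r lam x \<epsilon> - s * \<beta> * (norm (y - x))\<^sup>2 + E"
proof -
  define d w where "d = y - x" and "w i = dirl2_weight r (x $ i) (\<epsilon> $ i)" for i
  have w: "w i \<ge> 0" for i
    using dirl2_weight_nonneg[OF r] \<epsilon> by (simp add: w_def)
  have y_eq: "y $ i = x $ i + d $ i" for i by (simp add: d_def)
  let ?P = "\<lambda>x. \<Sum>i\<in>UNIV. r (sqrt ((x $ i)\<^sup>2 + (\<epsilon> $ i)\<^sup>2))"
  let ?S1 = "\<Sum>i\<in>UNIV. w i * x $ i * d $ i" and ?S2 = "\<Sum>i\<in>UNIV. w i * (d $ i)\<^sup>2"
  have opt: "grad f x \<bullet> d + \<beta> * (norm d)\<^sup>2 + 2 * lam * (?S1 + ?S2) = 0"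
    using dirl2_model_minimizer[OF y, of d]
    unfolding power2_norm_eq_inner
    by (simp add: y_eq power2_eq_square algebra_simps sum.distrib flip: w_def d_def)
  have "?P (x + s *\<^sub>R d) \<le> (\<Sum>i\<in>UNIV. r (sqrt ((x $ i)\<^sup>2 + (\<epsilon> $ i)\<^sup>2))
      + w i * (((x + s *\<^sub>R d) $ i)\<^sup>2 - (x $ i)\<^sup>2))"
    unfolding w_def using \<epsilon> by (intro sum_mono penalty_sqrt_le_quadratic r) auto
  also have "\<dots> = ?P x + (2 * s * ?S1 + s\<^sup>2 * ?S2)"
    by (simp add: sum.distrib sum_distrib_left power2_eq_square algebra_simps)
  \<comment> \<open>As 0 \<le> s \<le> 1 and the weights are nonnegative, the quadratic part may be
    raised to coefficient 2 s. The penalty terms then become s times those in \<open>opt\<close>,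
    and the gradient term cancels.\<close>
  also have "s\<^sup>2 * ?S2 \<le> 2 * s * ?S2"
  proof (rule mult_right_mono)
    have "s * s \<le> 1 * s"
      using s by (intro mult_right_mono) auto
    then show "s\<^sup>2 \<le> 2 * s"
      using s by (simp add: power2_eq_square)
    show "0 \<le> ?S2"
      using w by (intro sum_nonneg mult_nonneg_nonneg) auto
  qed
  finally have "lam * ?P (x + s *\<^sub>R d) \<le> lam * (?P x + (2 * s * ?S1 + 2 * s * ?S2))"
    using lam by (simp add: mult_left_mono)
  also have "\<dots> = lam * ?P x + s * (2 * lam * (?S1 + ?S2))"
    by (simp add: algebra_simps)
  also have "2 * lam * (?S1 + ?S2) = - (grad f x \<bullet> d + \<beta> * (norm d)\<^sup>2)"
    using opt by linarith
  finally show ?thesis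
    using f by (simp add: smoothed_objective_def algebra_simps flip: d_def)
qed

text \<open>A first-exit argument: the Lipschitz bound holds only inside the level set, so it is
  applied up to the first exit parameter, where the resulting decrease rules out an exit.\<close>

lemma dirl2_segment_in_level_set:
  assumes f: "\<And>x. (f has_derivative (\<lambda>h. grad f x \<bullet> h)) (at x)"
    and r: "admissible_penalty r" and lam: "lam > 0" and \<epsilon>: "\<forall>i. \<epsilon> $ i > 0"
    and y: "is_arg_min (dirl2_model f r lam \<beta> x \<epsilon>) (\<lambda>_. True) y"
    and x: "smoothed_objective f r lam x \<epsilon> \<le> c"
    and L: "L-lipschitz_on (level_set (objective f r lam) c) (grad f)"
    and \<alpha>: "0 < \<alpha>" "\<alpha> < 1" and \<beta>: "\<beta> > 0" "\<beta> > \<alpha> * L / 2"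
    and s: "0 \<le> s" "s \<le> \<alpha>"
  shows "x + s *\<^sub>R (y - x) \<in> level_set (objective f r lam) c"
proof (rule ccontr)
  assume s_out: "x + s *\<^sub>R (y - x) \<notin> level_set (objective f r lam) c"
  define d where "d = y - x"
  define \<psi> where "\<psi> t = objective f r lam (x + t *\<^sub>R d)" for t
  have "continuous_on UNIV f"
    using f has_derivative_continuous by (blast intro: continuous_at_imp_continuous_on)
  then have "continuous_on UNIV (objective f r lam)"
    using r by (intro continuous_on_objective) (auto simp: admissible_penalty_def)
  then have cont: "continuous_on UNIV \<psi>"
    unfolding \<psi>_def by (rule continuous_on_compose2) (auto intro!: continuous_intros)
  have level: "x + t *\<^sub>R d \<in> level_set (objective f r lam) c \<longleftrightarrow> \<psi> t \<le> c" for t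
    by (simp add: level_set_def \<psi>_def)
  have "\<psi> 0 \<le> c"
    using objective_le_smoothed[OF r lam, of f x \<epsilon>] x by (simp add: \<psi>_def)
  have "d \<noteq> 0"
    using s_out level[of s] \<open>\<psi> 0 \<le> c\<close> by (auto simp: \<psi>_def simp flip: d_def)
  \<comment> \<open>\<open>B\<close> collects the parameters outside the level set. It stops at
    \<alpha>, since \<beta> > \<alpha> L / 2 controls only such steps.\<close>
  define B where "B = {t. 0 \<le> t \<and> t \<le> \<alpha> \<and> \<psi> t > c}"
  define s0 where "s0 = Inf B"
  have "s \<in> B"
    using s_out level[of s] s by (auto simp: B_def simp flip: d_def)
  have bdd: "bdd_below B"
    by (rule bdd_belowI[of _ 0]) (auto simp: B_def)
  have "0 \<le> s0"
    unfolding s0_def using \<open>s \<in> B\<close> by (intro cInf_greatest) (auto simp: B_def)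
  have "s0 \<le> \<alpha>"
    unfolding s0_def using cInf_lower[OF \<open>s \<in> B\<close> bdd] s by simp
  have below: "\<psi> t \<le> c" if "0 \<le> t" "t < s0" for t
    using that cInf_lower[OF _ bdd, of t] \<open>s0 \<le> \<alpha>\<close> by (force simp: B_def s0_def)
  \<comment> \<open>The exit parameter itself is still inside, by closedness of the level set. The
    case \<open>s0 = 0\<close> is separate because the half-open interval is then empty.\<close>
  have upto: "\<psi> t \<le> c" if "0 \<le> t" "t \<le> s0" for t
  proof (cases "s0 = 0")
    case False
    have "closed {t. \<psi> t \<le> c}"
      using cont by (intro closed_Collect_le) auto
    then have "closure {0..<s0} \<subseteq> {t. \<psi> t \<le> c}"
      using below by (intro closure_minimal) auto
    then show ?thesis
      using that False by (auto simp: closure_atLeastLessThan)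
  qed (use that \<open>\<psi> 0 \<le> c\<close> in simp)
  have "\<exists>\<delta>>0. \<forall>t. s0 < t \<longrightarrow> t < s0 + \<delta> \<longrightarrow> t \<le> \<alpha> \<longrightarrow> \<psi> t \<le> c"
  proof (cases "s0 = 0")
    case True
    \<comment> \<open>If the exit were at once, no segment would be available for the Lipschitz
      bound. Differentiability at \<open>x\<close> suffices for small t: the expansion error is
      below t \<beta> |d|^2, exactly what the proximal term gains.\<close>
    define h where "h t = f (x + t *\<^sub>R d) - t * (grad f x \<bullet> d) - t * (\<beta> * (norm d)\<^sup>2)" for t
    have "((\<lambda>t. f (x + t *\<^sub>R d)) has_derivative (\<lambda>u. grad f x \<bullet> (u *\<^sub>R d))) (at 0)"
      by (rule has_derivative_compose[where g = f]) (auto intro!: derivative_eq_intros f)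
    then have "((\<lambda>t. f (x + t *\<^sub>R d)) has_real_derivative grad f x \<bullet> d) (at 0)"
      by (simp add: has_field_derivative_def mult.commute[of _ "_ \<bullet> _"])
    then have "(h has_real_derivative - (\<beta> * (norm d)\<^sup>2)) (at 0)"
      unfolding h_def by (auto intro!: derivative_eq_intros)
    then obtain \<delta> where \<delta>: "\<delta> > 0" "\<And>t. 0 < t \<Longrightarrow> t < \<delta> \<Longrightarrow> h t < h 0"
      using DERIV_neg_dec_right[of h "- (\<beta> * (norm d)\<^sup>2)" 0] \<beta>(1) \<open>d \<noteq> 0\<close> by auto
    have "\<psi> t \<le> c" if "0 < t" "t < \<delta>" "t \<le> \<alpha>" for t
    proof -
      have "f (x + t *\<^sub>R (y - x)) \<le> f x + t * (grad f x \<bullet> (y - x)) + t * (\<beta> * (norm d)\<^sup>2)"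
        using \<delta>(2)[OF that(1,2)] by (simp add: h_def flip: d_def)
      note dirl2_smoothed_objective_bound[OF r lam \<epsilon> y _ _ this]
      then have "smoothed_objective f r lam (x + t *\<^sub>R d) \<epsilon> \<le> smoothed_objective f r lam x \<epsilon>"
        using that \<alpha> by (simp add: d_def)
      then show ?thesis
        using objective_le_smoothed[OF r lam, of f "x + t *\<^sub>R d" \<epsilon>] x by (simp add: \<psi>_def)
    qed
    then show ?thesis using \<delta>(1) True by auto
  next
    case False
    then have "s0 > 0" using \<open>0 \<le> s0\<close> by simp
    have "f (x + s0 *\<^sub>R d) \<le> f x + s0 * (grad f x \<bullet> d) + L / 2 * s0\<^sup>2 * (norm d)\<^sup>2"
      using upto level \<open>0 \<le> s0\<close> by (intro lipschitz_grad_quadratic_bound[OF f L]) auto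
    then have "smoothed_objective f r lam (x + s0 *\<^sub>R d) \<epsilon> \<le> smoothed_objective f r lam x \<epsilon>
        - s0 * \<beta> * (norm d)\<^sup>2 + L / 2 * s0\<^sup>2 * (norm d)\<^sup>2"
      unfolding d_def using \<open>s0 \<le> \<alpha>\<close> \<open>0 \<le> s0\<close> \<alpha>
      by (intro dirl2_smoothed_objective_bound[OF r lam \<epsilon> y]) auto
    also have "\<dots> = smoothed_objective f r lam x \<epsilon> - s0 * (\<beta> - s0 * L / 2) * (norm d)\<^sup>2"
      by (simp add: power2_eq_square algebra_simps)
    \<comment> \<open>Strictness matters: F < c at \<open>s0\<close> persists on a neighbourhood, so
      the exit cannot happen there.\<close>
    also have "\<dots> < smoothed_objective f r lam x \<epsilon>"
    proof -
      have "s0 * L \<le> \<alpha> * L"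
        using \<open>s0 \<le> \<alpha>\<close> lipschitz_on_nonneg[OF L] by (rule mult_right_mono)
      then show ?thesis using \<beta>(2) \<open>s0 > 0\<close> \<open>d \<noteq> 0\<close> by simp
    qed
    finally have "\<psi> s0 < c"
      using objective_le_smoothed[OF r lam, of f "x + s0 *\<^sub>R d" \<epsilon>] x by (simp add: \<psi>_def)
    moreover have "open {t. \<psi> t < c}"
      using cont by (intro open_Collect_less) auto
    ultimately obtain \<delta> where "\<delta> > 0" "ball s0 \<delta> \<subseteq> {t. \<psi> t < c}"
      by (meson mem_Collect_eq openE)
    moreover have "t \<in> ball s0 \<delta>" if "s0 < t" "t < s0 + \<delta>" for t
      using that by (simp add: dist_real_def)
    ultimately show ?thesis
      by (metis (lifting) less_imp_le mem_Collect_eq subsetD)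
  qed
  then obtain \<delta> where \<delta>: "\<delta> > 0" "\<And>t. s0 < t \<Longrightarrow> t < s0 + \<delta> \<Longrightarrow> t \<le> \<alpha> \<Longrightarrow> \<psi> t \<le> c"
    by blast
  \<comment> \<open>Points of \<open>B\<close> lie arbitrarily close to its infimum, but none lies
    in [0, s0] or in (s0, s0 + \<delta>).\<close>
  obtain t where "t \<in> B" "t < s0 + \<delta>"
    using cInf_lessD[of B "s0 + \<delta>"] \<open>s \<in> B\<close> \<delta>(1) by (auto simp: s0_def)
  then show False
    using \<delta>(2)[of t] upto[of t] by (cases "t \<le> s0") (auto simp: B_def)
qed

lemma dirl2_sufficient_decrease:
  assumes f: "\<And>x. (f has_derivative (\<lambda>h. grad f x \<bullet> h)) (at x)"
    and r: "admissible_penalty r" and lam: "lam > 0" and \<epsilon>: "\<forall>i. \<epsilon> $ i > 0"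
    and y: "is_arg_min (dirl2_model f r lam \<beta> x \<epsilon>) (\<lambda>_. True) y"
    and x: "smoothed_objective f r lam x \<epsilon> \<le> c"
    and L: "L-lipschitz_on (level_set (objective f r lam) c) (grad f)"
    and \<alpha>: "0 < \<alpha>" "\<alpha> < 1" and \<beta>: "\<beta> > 0" "\<beta> > \<alpha> * L / 2"
  shows "smoothed_objective f r lam (x + \<alpha> *\<^sub>R (y - x)) \<epsilon>
           \<le> smoothed_objective f r lam x \<epsilon> - \<alpha> * (\<beta> - \<alpha> * L / 2) * (norm (y - x))\<^sup>2"
proof -
  have "f (x + \<alpha> *\<^sub>R (y - x))
      \<le> f x + \<alpha> * (grad f x \<bullet> (y - x)) + L / 2 * \<alpha>\<^sup>2 * (norm (y - x))\<^sup>2"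
    using dirl2_segment_in_level_set[OF assms] \<alpha> by (intro lipschitz_grad_quadratic_bound[OF f L]) auto
  then have "smoothed_objective f r lam (x + \<alpha> *\<^sub>R (y - x)) \<epsilon> \<le> smoothed_objective f r lam x \<epsilon>
      - \<alpha> * \<beta> * (norm (y - x))\<^sup>2 + L / 2 * \<alpha>\<^sup>2 * (norm (y - x))\<^sup>2"
    using \<alpha> by (intro dirl2_smoothed_objective_bound[OF r lam \<epsilon> y]) auto
  then show ?thesis
    by (simp add: power2_eq_square algebra_simps)
qed

section \<open>Passage to the limit along a subsequence\<close>

theorem theorem4p4:
  fixes f :: "real ^ 'n \<Rightarrow> real"
    and r :: "real \<Rightarrow> real"
    and lam \<alpha> \<mu> \<beta> L :: real
    and x \<epsilon> :: "nat \<Rightarrow> real ^ 'n"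
    and xstar :: "real ^ 'n"
  assumes f_C2: "C2_on UNIV f"
    and lambda: "lam > 0"
    and A1: "admissible_penalty r"
    and A2: "nondegenerate_critical_points (objective f r lam)"
    and A3: "bounded (level_set (objective f r lam) (smoothed_objective f r lam (x 0) (\<epsilon> 0)))"
    and eps0: "\<forall>i. \<epsilon> 0 $ i > 0"
    and alpha: "\<alpha> \<in> {0<..<1}"
    and mu: "\<mu> \<in> {0<..<1}"
    and L: "L-lipschitz_on
              (level_set (objective f r lam) (smoothed_objective f r lam (x 0) (\<epsilon> 0))) (grad f)"
    and beta: "\<beta> > 0" "\<beta> > \<alpha> * L / 2"
    and dirl2: "dirl2_sequence f r lam \<alpha> \<mu> \<beta> x \<epsilon>"
    and xstar: "xstar \<in> limit_points x"
    and case_hyp: "zero_indices xstar = {} \<or> slope_at_0 r = \<infinity>"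
  shows "stationary f r lam xstar"
proof -
  let ?F = "objective f r lam"
  let ?c = "smoothed_objective f r lam (x 0) (\<epsilon> 0)"
  note f = C2_on_UNIV_grad(1)[OF f_C2]
  have \<alpha>: "0 < \<alpha>" "\<alpha> < 1" and \<mu>: "0 < \<mu>" "\<mu> < 1"
    using alpha mu by auto
  obtain y where y: "\<And>k. is_arg_min (dirl2_model f r lam \<beta> (x k) (\<epsilon> k)) (\<lambda>_. True) (y k)"
    and x_Suc: "\<And>k. x (Suc k) = (1 - \<alpha>) *\<^sub>R x k + \<alpha> *\<^sub>R y k"
    and \<epsilon>_Suc: "\<And>k. \<epsilon> (Suc k) = (1 - \<alpha> * (1 - \<mu>)) *\<^sub>R \<epsilon> k"
    using dirl2 unfolding dirl2_sequence_def by blast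
  \<comment> \<open>The contraction factor of the smoothing parameters. It lies in (0,1), so they
    stay positive and tend to 0.\<close>
  define q where "q = 1 - \<alpha> * (1 - \<mu>)"
  have "\<alpha> * (1 - \<mu>) < 1 * 1"
    using \<alpha> \<mu> by (intro mult_strict_mono) auto
  then have q: "0 < q" "q < 1"
    using \<alpha> \<mu> by (auto simp: q_def)
  have \<epsilon>_eq: "\<epsilon> k = q ^ k *\<^sub>R \<epsilon> 0" for k
    by (induction k) (auto simp: \<epsilon>_Suc simp flip: q_def)
  have \<epsilon>_pos: "\<forall>i. \<epsilon> k $ i > 0" for k
    using eps0 q by (simp add: \<epsilon>_eq[of k])
  define \<Phi> where "\<Phi> k = smoothed_objective f r lam (x k) (\<epsilon> k)" for k
  define \<gamma> where "\<gamma> = \<alpha> * (\<beta> - \<alpha> * L / 2)"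
  have "\<gamma> > 0" using \<alpha> beta by (simp add: \<gamma>_def)
  have x_Suc': "x (Suc k) = x k + \<alpha> *\<^sub>R (y k - x k)" for k
    by (simp add: x_Suc algebra_simps)
  \<comment> \<open>The decrease presupposes a start with smoothed value at most the initial one,
    where the Lipschitz constant is valid; the induction for \<open>\<Phi>_le\<close> removes this
    premise.\<close>
  have step: "\<Phi> (Suc k) \<le> \<Phi> k - \<gamma> * (norm (y k - x k))\<^sup>2" if "\<Phi> k \<le> ?c" for k
  proof -
    have "\<Phi> (Suc k) \<le> smoothed_objective f r lam (x (Suc k)) (\<epsilon> k)"
      unfolding \<Phi>_def \<epsilon>_Suc q_def[symmetric] using q
      by (intro smoothed_objective_shrink A1 lambda) auto
    also have "\<dots> \<le> \<Phi> k - \<gamma> * (norm (y k - x k))\<^sup>2"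
      unfolding x_Suc' \<Phi>_def \<gamma>_def
      using that by (intro dirl2_sufficient_decrease[OF f A1 lambda \<epsilon>_pos y _ L \<alpha> beta]) (simp add: \<Phi>_def)
    finally show ?thesis .
  qed
  have \<Phi>_le: "\<Phi> k \<le> ?c" for k
  proof (induction k)
    case (Suc k)
    have "0 \<le> \<gamma> * (norm (y k - x k))\<^sup>2"
      using \<open>\<gamma> > 0\<close> by simp
    then show ?case using step[OF Suc] Suc by linarith
  qed (simp add: \<Phi>_def)
  have "decseq \<Phi>"
  proof (rule decseq_SucI)
    fix k
    have "0 \<le> \<gamma> * (norm (y k - x k))\<^sup>2"
      using \<open>\<gamma> > 0\<close> by simp
    then show "\<Phi> (Suc k) \<le> \<Phi> k" using step[OF \<Phi>_le[of k]] by linarith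
  qed
  obtain \<phi> :: "nat \<Rightarrow> nat" where \<phi>: "strict_mono \<phi>" and x_lim: "(\<lambda>k. x (\<phi> k)) \<longlonglongrightarrow> xstar"
    using xstar by (auto simp: limit_points_def o_def)
  have "continuous_on UNIV f"
    using f has_derivative_continuous by (blast intro: continuous_at_imp_continuous_on)
  then have "continuous_on UNIV ?F"
    using A1 by (intro continuous_on_objective) (auto simp: admissible_penalty_def)
  then have "(\<lambda>k. ?F (x (\<phi> k))) \<longlonglongrightarrow> ?F xstar"
    by (rule continuous_on_tendsto_compose[OF _ x_lim]) auto
  then obtain b where b: "\<And>k. b \<le> ?F (x (\<phi> k))"
    by (metis BseqE abs_le_D2 convergentI convergent_imp_Bseq minus_le_iff real_norm_def)
  \<comment> \<open>The bound \<open>b\<close> is known only along \<phi>. Monotonicity of \<Phi>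
    and \<phi> k \<ge> k extend it to every index.\<close>
  have "b \<le> \<Phi> k" for k
  proof -
    have "b \<le> \<Phi> (\<phi> k)"
      using b[of k] objective_le_smoothed[OF A1 lambda, of f "x (\<phi> k)" "\<epsilon> (\<phi> k)"] by (simp add: \<Phi>_def)
    also have "\<dots> \<le> \<Phi> k"
      using \<open>decseq \<Phi>\<close> seq_suble[OF \<phi>] by (rule decseqD)
    finally show ?thesis .
  qed
  then obtain l where "\<Phi> \<longlonglongrightarrow> l"
    using decseq_convergent[OF \<open>decseq \<Phi>\<close>, of b] by blast
  \<comment> \<open>Consecutive differences of a convergent sequence vanish in the limit, and by
    \<open>step\<close> they dominate \<gamma> times the squared step.\<close>
  then have "(\<lambda>k. (\<Phi> k - \<Phi> (Suc k)) / \<gamma>) \<longlonglongrightarrow> (l - l) / \<gamma>"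
    using \<open>\<gamma> > 0\<close> by (intro tendsto_intros LIMSEQ_Suc) auto
  then have "(\<lambda>k. (\<Phi> k - \<Phi> (Suc k)) / \<gamma>) \<longlonglongrightarrow> 0"
    by simp
  then have "(\<lambda>k. (norm (y k - x k))\<^sup>2) \<longlonglongrightarrow> 0"
  proof (rule tendsto_sandwich[rotated 3])
    show "\<forall>\<^sub>F k in sequentially. (norm (y k - x k))\<^sup>2 \<le> (\<Phi> k - \<Phi> (Suc k)) / \<gamma>"
      using step[OF \<Phi>_le] \<open>\<gamma> > 0\<close> by (auto intro!: always_eventually simp: field_simps)
  qed (auto simp: tendsto_const)
  then have "(\<lambda>k. sqrt ((norm (y k - x k))\<^sup>2)) \<longlonglongrightarrow> sqrt 0"
    by (rule tendsto_real_sqrt)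
  then have "(\<lambda>k. y k - x k) \<longlonglongrightarrow> 0"
    by (simp add: tendsto_norm_zero_iff)
  then have d_lim: "(\<lambda>k. y (\<phi> k) - x (\<phi> k)) \<longlonglongrightarrow> 0"
    using LIMSEQ_subseq_LIMSEQ[OF _ \<phi>] by (force simp: o_def)
  have "(\<lambda>k. q ^ k *\<^sub>R \<epsilon> 0) \<longlonglongrightarrow> 0 *\<^sub>R \<epsilon> 0"
    using q by (intro tendsto_intros LIMSEQ_realpow_zero) auto
  then have "\<epsilon> \<longlonglongrightarrow> 0"
    by (simp flip: \<epsilon>_eq)
  then have \<epsilon>_lim: "(\<lambda>k. \<epsilon> (\<phi> k)) \<longlonglongrightarrow> 0"
    using LIMSEQ_subseq_LIMSEQ[OF _ \<phi>] by (force simp: o_def)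
  have "(\<lambda>k. x (\<phi> k) + (y (\<phi> k) - x (\<phi> k))) \<longlonglongrightarrow> xstar + 0"
    by (intro tendsto_add x_lim d_lim)
  then have y_lim: "(\<lambda>k. y (\<phi> k)) \<longlonglongrightarrow> xstar" by simp
  have grad_lim: "(\<lambda>k. grad f (x (\<phi> k))) \<longlonglongrightarrow> grad f xstar"
    by (rule continuous_on_tendsto_compose[OF C2_on_UNIV_grad(2)[OF f_C2] x_lim]) auto
  have "grad f xstar $ i = - lam * sgn (xstar $ i) * deriv r \<bar>xstar $ i\<bar>"
    if "xstar $ i \<noteq> 0" for i
  proof -
    let ?a = "\<bar>xstar $ i\<bar>"
    let ?s = "\<lambda>k. sqrt ((x (\<phi> k) $ i)\<^sup>2 + (\<epsilon> (\<phi> k) $ i)\<^sup>2)"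
    have "?s \<longlonglongrightarrow> sqrt ((xstar $ i)\<^sup>2 + (0 $ i)\<^sup>2)"
      by (intro tendsto_intros x_lim \<epsilon>_lim)
    then have s_lim: "?s \<longlonglongrightarrow> ?a" by simp
    \<comment> \<open>Away from 0 the weights converge although the smoothing vanishes, because r'
      is continuous at |x*_i| > 0.\<close>
    have "isCont (deriv r) ?a"
      using C2_on_greaterThan_deriv(2)[of 0 r] A1 that
      by (simp add: admissible_penalty_def continuous_on_eq_continuous_at)
    then have "(\<lambda>k. deriv r (?s k)) \<longlonglongrightarrow> deriv r ?a"
      using s_lim by (rule isCont_tendsto_compose)
    then have w_lim: "(\<lambda>k. dirl2_weight r (x (\<phi> k) $ i) (\<epsilon> (\<phi> k) $ i)) \<longlonglongrightarrow> deriv r ?a / (2 * ?a)"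
      unfolding dirl2_weight_def using s_lim that by (intro tendsto_intros) auto
    \<comment> \<open>Testing the optimality condition with the i-th unit vector isolates one
      component, so weights at zero components, which may blow up, never enter the limit.\<close>
    have opt: "grad f (x k) $ i + \<beta> * (y k - x k) $ i
        + 2 * lam * (dirl2_weight r (x k $ i) (\<epsilon> k $ i) * y k $ i) = 0" for k
    proof -
      have "(\<Sum>j\<in>UNIV. dirl2_weight r (x k $ j) (\<epsilon> k $ j) * y k $ j * axis i 1 $ j)
          = dirl2_weight r (x k $ i) (\<epsilon> k $ i) * y k $ i"
        by (simp add: axis_def if_distrib cong: if_cong)
      then show ?thesis
        using dirl2_model_minimizer[OF y[of k], of "axis i 1"] by (simp add: inner_axis)
    qed
    have "(\<lambda>k. grad f (x (\<phi> k)) $ i + \<beta> * (y (\<phi> k) - x (\<phi> k)) $ i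
        + 2 * lam * (dirl2_weight r (x (\<phi> k) $ i) (\<epsilon> (\<phi> k) $ i) * y (\<phi> k) $ i))
        \<longlonglongrightarrow> grad f xstar $ i + \<beta> * 0 $ i + 2 * lam * (deriv r ?a / (2 * ?a) * xstar $ i)"
      by (intro tendsto_add tendsto_mult tendsto_const tendsto_vec_nth grad_lim d_lim y_lim w_lim)
    then have "grad f xstar $ i + 2 * lam * (deriv r ?a / (2 * ?a) * xstar $ i) = 0"
      unfolding opt by (simp add: LIMSEQ_const_iff)
    then show ?thesis
      using that by (simp add: sgn_real_def abs_real_def split: if_splits)
  qed
  \<comment> \<open>If such an index exists, the slope at 0 is infinite, and with
    \<open>lam > 0\<close> the interval contains every real number.\<close>
  moreover have "ereal (grad f xstar $ i) \<in> {- (ereal lam * slope_at_0 r)<..<ereal lam * slope_at_0 r}"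
    if "xstar $ i = 0" for i
    using case_hyp that lambda by (auto simp: zero_indices_def)
  ultimately show ?thesis
    by (simp add: stationary_def nonzero_indices_def zero_indices_def)
qed

end
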